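(* There exists a finite, positive Borel measure $\mu$ with support in $\overline{\mathbb{D}}$ such that: (i) $\mu(\mathbb{T})>0$; (ii) $P^2(\mu)$ is irreducible; (iii) every point in $\mathbb{D}$ is an analytic bounded point evaluation for $P^2(\mu)$; and (iv) there is a closed, shift invariant subspace $\mathcal{M}$ of $P^2(\mu)$ such that $\mathcal{M}\ominus z\mathcal{M}$ does not generate $\mathcal{M}$.
   Context: $\mathbb{D}=\{z\in\mathbb{C}:|z|<1\}$ and $\mathbb{T}=\{z\in\mathbb{C}:|z|=1\}$. For a finite, positive, compactly supported Borel measure $\mu$ on $\mathbb{C}$, $P^2(\mu)$ denotes the closure of the analytic polynomials (polynomials in $z$) in $L^2(\mu)$. $P^2(\mu)$ is called irreducible if it contains no nontrivial characteristic function (i.e. no characteristic function of a Borel set other than those equal $\mu$-a.e. to $0$ or $1$). A point $z_0\in\mathbb{C}$ is a bounded point evaluation for $P^2(\mu)$ if $p\mapsto p(z_0)$ is a bounded linear functional on the analytic polynomials with respect to the $L^2(\mu)$ norm; $\mathrm{bpe}(P^2(\mu))$ is the set of all such points. A point $z_0$ is an analytic bounded point evaluation for $P^2(\mu)$ if $z_0$ is in the interior of $\mathrm{bpe}(P^2(\mu))$ and there exist positive constants $r$ and $M$ such that $|p(z)|\le M\|p\|_{L^2(\mu)}$ whenever $|z-z_0|\le r$ and $p$ is an analytic polynomial. The shift on $P^2(\mu)$ is multiplication by $z$; a closed subspace $\mathcal{M}$ is shift invariant if $z\mathcal{M}\subseteq\mathcal{M}$. $\mathcal{M}\ominus z\mathcal{M}$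 is the orthogonal complement of $z\mathcal{M}$ in $\mathcal{M}$. It generates $\mathcal{M}$ if the smallest closed shift invariant subspace of $P^2(\mu)$ containing $\mathcal{M}\ominus z\mathcal{M}$ is $\mathcal{M}$. *)

theory Defs
  imports "HOL-Analysis.Analysis" "HOL-Computational_Algebra.Polynomial"
begin

definition finite_borel_measure :: "complex measure \<Rightarrow> bool" where
  "finite_borel_measure \<mu> \<longleftrightarrow> sets \<mu> = sets borel \<and> finite_measure \<mu>"

definition msupport :: "complex measure \<Rightarrow> complex set" where
  "msupport \<mu> = {z. \<forall>U. open U \<longrightarrow> z \<in> U \<longrightarrow> emeasure \<mu> U > 0}"

text \<open>
  Elements of the Hilbert space are represented by square-integrable functions; no quotient by
  almost-everywhere equality is formed. A set that is closed in the sense of \<open>l2_closed\<close> is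
  saturated under almost-everywhere equality, so closed subspaces in the sense below correspond
  exactly to the closed subspaces of the quotient.
\<close>

definition L2 :: "complex measure \<Rightarrow> (complex \<Rightarrow> complex) set" where
  "L2 \<mu> = {f \<in> borel_measurable \<mu>. integrable \<mu> (\<lambda>z. (norm (f z))\<^sup>2)}"

definition l2_inner :: "complex measure \<Rightarrow> (complex \<Rightarrow> complex) \<Rightarrow> (complex \<Rightarrow> complex) \<Rightarrow> complex" where
  "l2_inner \<mu> f g = (\<integral>z. f z * cnj (g z) \<partial>\<mu>)"

definition l2_norm :: "complex measure \<Rightarrow> (complex \<Rightarrow> complex) \<Rightarrow> real" where
  "l2_norm \<mu> f = sqrt (\<integral>z. (norm (f z))\<^sup>2 \<partial>\<mu>)"

definition l2_closure :: "complex measure \<Rightarrow> (complex \<Rightarrow> complex) set \<Rightarrow> (complex \<Rightarrow> complex) set" where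
  "l2_closure \<mu> S = {f \<in> L2 \<mu>. \<forall>e>0. \<exists>g\<in>S. l2_norm \<mu> (\<lambda>z. f z - g z) < e}"

definition l2_closed :: "complex measure \<Rightarrow> (complex \<Rightarrow> complex) set \<Rightarrow> bool" where
  "l2_closed \<mu> S \<longleftrightarrow> l2_closure \<mu> S \<subseteq> S"

text \<open>
  The definitions below are meant for finite Borel measures with compact support; the polynomials
  are then square-integrable (lemma \<open>poly_in_L2\<close>).
\<close>

definition P2 :: "complex measure \<Rightarrow> (complex \<Rightarrow> complex) set" where
  "P2 \<mu> = l2_closure \<mu> (range poly)"

definition P2_irreducible :: "complex measure \<Rightarrow> bool" where
  "P2_irreducible \<mu> \<longleftrightarrow>
     (\<forall>A \<in> sets borel. indicator A \<in> P2 \<mu> \<longrightarrow> (AE z in \<mu>. z \<notin> A) \<or> (AE z in \<mu>. z \<in> A))"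

definition bpe :: "complex measure \<Rightarrow> complex set" where
  "bpe \<mu> = {z\<^sub>0. \<exists>C. \<forall>p. norm (poly p z\<^sub>0) \<le> C * l2_norm \<mu> (poly p)}"

definition abpe :: "complex measure \<Rightarrow> complex set" where
  "abpe \<mu> = {z\<^sub>0 \<in> interior (bpe \<mu>).
     \<exists>r>0. \<exists>C>0. \<forall>z p. norm (z - z\<^sub>0) \<le> r \<longrightarrow> norm (poly p z) \<le> C * l2_norm \<mu> (poly p)}"

definition shift :: "(complex \<Rightarrow> complex) \<Rightarrow> complex \<Rightarrow> complex" where
  "shift f = (\<lambda>z. z * f z)"

definition fun_subspace :: "(complex \<Rightarrow> complex) set \<Rightarrow> bool" where
  "fun_subspace S \<longleftrightarrow> (\<lambda>z. 0) \<in> S \<and>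
     (\<forall>f\<in>S. \<forall>g\<in>S. (\<lambda>z. f z + g z) \<in> S) \<and>
     (\<forall>c. \<forall>f\<in>S. (\<lambda>z. c * f z) \<in> S)"

definition closed_invariant_subspace :: "complex measure \<Rightarrow> (complex \<Rightarrow> complex) set \<Rightarrow> bool" where
  "closed_invariant_subspace \<mu> S \<longleftrightarrow>
     S \<subseteq> P2 \<mu> \<and> fun_subspace S \<and> l2_closed \<mu> S \<and> shift ` S \<subseteq> S"

definition orth_within ::
  "complex measure \<Rightarrow> (complex \<Rightarrow> complex) set \<Rightarrow> (complex \<Rightarrow> complex) set \<Rightarrow> (complex \<Rightarrow> complex) set" where
  "orth_within \<mu> S N = {f \<in> S. \<forall>g\<in>N. l2_inner \<mu> f g = 0}"

definition invariant_hull ::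
  "complex measure \<Rightarrow> (complex \<Rightarrow> complex) set \<Rightarrow> (complex \<Rightarrow> complex) set" where
  "invariant_hull \<mu> S = \<Inter>{N. closed_invariant_subspace \<mu> N \<and> S \<subseteq> N}"

lemma emeasure_outside_msupport:
  assumes "sets \<mu> = sets borel"
  shows "emeasure \<mu> (- msupport \<mu>) = 0"
proof -
  define F where "F = {U. open U \<and> emeasure \<mu> U = 0}"
  obtain F' where F': "F' \<subseteq> F" "countable F'" "\<Union>F' = \<Union>F"
    using Lindelof[of F] unfolding F_def by blast
  have "- msupport \<mu> = \<Union>F"
    unfolding msupport_def F_def by (auto simp: zero_less_iff_neq_zero)
  moreover have "(\<Union>U\<in>F'. U) \<in> null_sets \<mu>"
    using F' assms by (intro null_sets_UN') (auto simp: F_def null_sets_def)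
  ultimately show ?thesis using F' by auto
qed

lemma poly_in_L2:
  assumes "finite_borel_measure \<mu>" "bounded (msupport \<mu>)"
  shows "poly p \<in> L2 \<mu>"
proof -
  have sets: "sets \<mu> = sets borel" and fin: "finite_measure \<mu>"
    using assms by (auto simp: finite_borel_measure_def)
  interpret finite_measure \<mu> by (fact fin)
  have cont: "continuous_on A (poly p)" for A by (intro continuous_intros)
  have meas: "poly p \<in> borel_measurable \<mu>"
    using borel_measurable_continuous_onI[OF cont] sets measurable_cong_sets by blast
  have "bounded (poly p ` closure (msupport \<mu>))"
    using assms(2) by (intro compact_imp_bounded compact_continuous_image cont) simp
  then obtain B where B: "\<And>z. z \<in> msupport \<mu> \<Longrightarrow> norm (poly p z) \<le> B"
    unfolding bounded_iff using closure_subset by blast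
  have cl: "- msupport \<mu> = \<Union>{U. open U \<and> emeasure \<mu> U = 0}"
    unfolding msupport_def by (auto simp: zero_less_iff_neq_zero)
  have "open (- msupport \<mu>)" unfolding cl by auto
  then have "- msupport \<mu> \<in> null_sets \<mu>"
    using emeasure_outside_msupport[OF sets] sets by (auto simp: null_sets_def)
  then have "AE z in \<mu>. z \<in> msupport \<mu>"
    by (auto dest: AE_not_in)
  then have "AE z in \<mu>. norm ((norm (poly p z))\<^sup>2) \<le> B\<^sup>2"
    by eventually_elim (auto intro!: power_mono B)
  then have "integrable \<mu> (\<lambda>z. (norm (poly p z))\<^sup>2)"
    using meas by (intro integrable_const_bound) auto
  with meas show ?thesis by (simp add: L2_def)
qed

end

theory Submission
  imports Defs "HOL-Complex_Analysis.Cauchy_Integral_Formula"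
begin

text \<open>
  Take normalized arc length \<open>m\<close> on the unit circle plus a point mass of size 6 at \<open>1/2\<close>, and
  \<open>M = P2 \<mu>\<close>. Evaluations on the disc are already bounded in the norm of \<open>L\<^sup>2(m)\<close>, so adding the
  atom only replaces the norm of the Hardy space by an equivalent one.

  Irreducibility: \<open>m\<close> is multiplicative on polynomials (the mean of \<open>p\<^sup>2\<close> is \<open>p(0)\<^sup>2\<close>), hence
  \<open>m(A) = m(A)\<^sup>2\<close> if the indicator of \<open>A\<close> is a limit of polynomials; then this indicator is
  constant on the circle almost everywhere, and evaluation at the atom forces the same constant there.

  Failure of generation: adding a point mass \<open>c\<close> at \<open>a\<close> changes the Szego kernel \<open>k\<close> to
  \<open>K\<^sub>w = k\<^sub>w - c k\<^sub>w(a) / (1 + c k\<^sub>a(a)) k\<^sub>a\<close>. For \<open>a = 1/2\<close>, \<open>w = 2/3\<close>, \<open>c = 6\<close> the coefficient is 1,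
  so \<open>K\<^sub>w = k\<^sub>w - k\<^sub>a\<close> vanishes at 0 and lies in \<open>z M\<close>. Whatever is orthogonal to \<open>z M\<close> therefore
  vanishes at \<open>2/3\<close>, and so does everything it generates, but the constant 1 does not.
\<close>

section \<open>Square-integrable functions and closures of subspaces\<close>

text \<open>Integrating (a + b)^2 \<le> 2 a^2 + 2 b^2 gives a triangle inequality with constant 2.
  That suffices for approximation arguments; the constant is why errors of e/4 are chosen when two
  are added.\<close>

lemma L2_add:
  assumes "f \<in> L2 \<mu>" "g \<in> L2 \<mu>"
  shows "(\<lambda>z. f z + g z) \<in> L2 \<mu>" "l2_norm \<mu> (\<lambda>z. f z + g z) \<le> 2 * (l2_norm \<mu> f + l2_norm \<mu> g)"
proof -
  have [measurable]: "f \<in> borel_measurable \<mu>" "g \<in> borel_measurable \<mu>"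
    and f: "integrable \<mu> (\<lambda>z. (norm (f z))\<^sup>2)" and g: "integrable \<mu> (\<lambda>z. (norm (g z))\<^sup>2)"
    using assms by (auto simp: L2_def)
  have bd: "(norm (f z + g z))\<^sup>2 \<le> 2 * (norm (f z))\<^sup>2 + 2 * (norm (g z))\<^sup>2" for z
  proof -
    have "(norm (f z + g z))\<^sup>2 \<le> (norm (f z) + norm (g z))\<^sup>2"
      by (intro power_mono norm_triangle_ineq) auto
    also have "\<dots> \<le> 2 * (norm (f z))\<^sup>2 + 2 * (norm (g z))\<^sup>2"
      using sum_squares_bound[of "norm (f z)" "norm (g z)"] by (simp add: power2_sum)
    finally show ?thesis .
  qed
  have i: "integrable \<mu> (\<lambda>z. (norm (f z + g z))\<^sup>2)"
  proof (rule Bochner_Integration.integrable_bound)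
    show "integrable \<mu> (\<lambda>z. 2 * (norm (f z))\<^sup>2 + 2 * (norm (g z))\<^sup>2)"
      using f g by simp
    show "AE z in \<mu>. norm ((norm (f z + g z))\<^sup>2) \<le> norm (2 * (norm (f z))\<^sup>2 + 2 * (norm (g z))\<^sup>2)"
      using bd by (intro AE_I2) simp
  qed measurable
  then show "(\<lambda>z. f z + g z) \<in> L2 \<mu>" by (simp add: L2_def)
  define A B where "A = (\<integral>z. (norm (f z))\<^sup>2 \<partial>\<mu>)" and "B = (\<integral>z. (norm (g z))\<^sup>2 \<partial>\<mu>)"
  have AB: "A \<ge> 0" "B \<ge> 0" by (auto simp: A_def B_def)
  have "(\<integral>z. (norm (f z + g z))\<^sup>2 \<partial>\<mu>) \<le> (\<integral>z. 2 * (norm (f z))\<^sup>2 + 2 * (norm (g z))\<^sup>2 \<partial>\<mu>)"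
    using f g i bd by (intro integral_mono) auto
  also have "\<dots> = 2 * A + 2 * B" using f g by (simp add: A_def B_def)
  also have "\<dots> \<le> (2 * (sqrt A + sqrt B))\<^sup>2"
    using AB by (simp add: power_mult_distrib power2_sum)
  finally show "l2_norm \<mu> (\<lambda>z. f z + g z) \<le> 2 * (l2_norm \<mu> f + l2_norm \<mu> g)"
    unfolding l2_norm_def A_def[symmetric] B_def[symmetric]
    using AB by (intro real_le_lsqrt) auto
qed

lemma L2_cmult:
  assumes "f \<in> L2 \<mu>"
  shows "(\<lambda>z. c * f z) \<in> L2 \<mu>" "l2_norm \<mu> (\<lambda>z. c * f z) = norm c * l2_norm \<mu> f"
  using assms by (auto simp: L2_def l2_norm_def norm_mult power_mult_distrib real_sqrt_mult)

lemma L2_diff: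
  assumes "f \<in> L2 \<mu>" "g \<in> L2 \<mu>"
  shows "(\<lambda>z. f z - g z) \<in> L2 \<mu>"
  using L2_add(1)[OF assms(1) L2_cmult(1)[OF assms(2), of "-1"]] by simp

lemma l2_norm_nonneg [simp]: "l2_norm \<mu> f \<ge> 0"
  by (simp add: l2_norm_def)

lemma l2_closureE:
  assumes "f \<in> l2_closure \<mu> S" "e > 0"
  obtains g where "g \<in> S" "l2_norm \<mu> (\<lambda>z. f z - g z) < e"
  using assms unfolding l2_closure_def by blast

lemma l2_closed_l2_closure:
  assumes "S \<subseteq> L2 \<mu>"
  shows "l2_closed \<mu> (l2_closure \<mu> S)"
  unfolding l2_closed_def
proof
  fix f assume f: "f \<in> l2_closure \<mu> (l2_closure \<mu> S)"
  have "\<exists>g\<in>S. l2_norm \<mu> (\<lambda>z. f z - g z) < e" if e: "e > 0" for e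
  proof -
    obtain h where h: "h \<in> l2_closure \<mu> S" "l2_norm \<mu> (\<lambda>z. f z - h z) < e/4"
      using l2_closureE[OF f, of "e/4"] e by auto
    obtain g where g: "g \<in> S" "l2_norm \<mu> (\<lambda>z. h z - g z) < e/4"
      using l2_closureE[OF h(1), of "e/4"] e by auto
    have "l2_norm \<mu> (\<lambda>z. (f z - h z) + (h z - g z)) \<le>
        2 * (l2_norm \<mu> (\<lambda>z. f z - h z) + l2_norm \<mu> (\<lambda>z. h z - g z))"
      using f h g assms by (intro L2_add L2_diff) (auto simp: l2_closure_def)
    with h g show ?thesis by (intro bexI[of _ g]) auto
  qed
  then show "f \<in> l2_closure \<mu> S" using f by (auto simp: l2_closure_def)
qed

lemma fun_subspace_l2_closure:
  assumes S: "S \<subseteq> L2 \<mu>" "fun_subspace S"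
  shows "fun_subspace (l2_closure \<mu> S)"
  unfolding fun_subspace_def
proof (intro conjI ballI allI)
  show "(\<lambda>z. 0) \<in> l2_closure \<mu> S"
    using S by (auto simp: l2_closure_def fun_subspace_def l2_norm_def intro!: bexI[of _ "\<lambda>z. 0"])
next
  fix f g assume f: "f \<in> l2_closure \<mu> S" and g: "g \<in> l2_closure \<mu> S"
  have "\<exists>h\<in>S. l2_norm \<mu> (\<lambda>z. f z + g z - h z) < e" if e: "e > 0" for e
  proof -
    obtain f' where f': "f' \<in> S" "l2_norm \<mu> (\<lambda>z. f z - f' z) < e/4"
      using l2_closureE[OF f, of "e/4"] e by auto
    obtain g' where g': "g' \<in> S" "l2_norm \<mu> (\<lambda>z. g z - g' z) < e/4"
      using l2_closureE[OF g, of "e/4"] e by auto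
    have "l2_norm \<mu> (\<lambda>z. (f z - f' z) + (g z - g' z)) \<le>
        2 * (l2_norm \<mu> (\<lambda>z. f z - f' z) + l2_norm \<mu> (\<lambda>z. g z - g' z))"
      using f g f' g' S by (intro L2_add L2_diff) (auto simp: l2_closure_def)
    with f' g' S(2) show ?thesis
      by (intro bexI[of _ "\<lambda>z. f' z + g' z"]) (auto simp: fun_subspace_def algebra_simps)
  qed
  then show "(\<lambda>z. f z + g z) \<in> l2_closure \<mu> S"
    using f g by (auto simp: l2_closure_def intro: L2_add)
next
  fix f c assume f: "f \<in> l2_closure \<mu> S"
  have "\<exists>h\<in>S. l2_norm \<mu> (\<lambda>z. c * f z - h z) < e" if "e > 0" for e
  proof -
    \<comment> \<open>The denominator \<open>norm c + 1\<close> also covers c = 0.\<close>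
    have "e / (norm c + 1) > 0" using that by (simp add: add_nonneg_pos)
    then obtain f' where f': "f' \<in> S" "l2_norm \<mu> (\<lambda>z. f z - f' z) < e / (norm c + 1)"
      using l2_closureE[OF f] by blast
    have "l2_norm \<mu> (\<lambda>z. c * (f z - f' z)) = norm c * l2_norm \<mu> (\<lambda>z. f z - f' z)"
      using f f' S by (intro L2_cmult L2_diff) (auto simp: l2_closure_def)
    also have "\<dots> \<le> norm c * (e / (norm c + 1))"
      using f' by (intro mult_left_mono) auto
    also have "\<dots> < e"
      using that pos_divide_less_eq[of "norm c + 1" "norm c * e" e] norm_ge_zero[of c]
      by (simp add: algebra_simps)
    finally show ?thesis
      using S(2) f' by (intro bexI[of _ "\<lambda>z. c * f' z"]) (auto simp: fun_subspace_def algebra_simps)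
  qed
  then show "(\<lambda>z. c * f z) \<in> l2_closure \<mu> S"
    using f by (auto simp: l2_closure_def intro: L2_cmult)
qed

lemma fun_subspace_polys: "fun_subspace (range poly)"
  unfolding fun_subspace_def
proof (intro conjI ballI allI)
  show "(\<lambda>z. 0) \<in> range (poly :: complex poly \<Rightarrow> _)" by (rule image_eqI[of _ _ 0]) auto
  show "(\<lambda>z. f z + g z) \<in> range poly" if "f \<in> range poly" "g \<in> range poly" for f g :: "complex \<Rightarrow> complex"
    using that by (auto intro!: image_eqI[of _ _ "_ + _"])
  show "(\<lambda>z. c * f z) \<in> range poly" if "f \<in> range poly" for c and f :: "complex \<Rightarrow> complex"
    using that by (auto intro!: image_eqI[of _ _ "smult c _"])
qed

section \<open>Measures carried by the closed unit disc\<close>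

text \<open>The support condition is put as an almost-everywhere statement, the form that integral
  estimates use. The inclusion for \<open>msupport\<close> is derived from it in the
  theorem.\<close>

definition disc_measure :: "complex measure \<Rightarrow> bool" where
  "disc_measure \<mu> \<longleftrightarrow> finite_borel_measure \<mu> \<and> (AE z in \<mu>. norm z \<le> 1)"

lemma disc_measure_bounded_L2:
  assumes \<mu>: "disc_measure \<mu>" and [measurable]: "f \<in> borel_measurable borel"
    and B: "\<And>z. norm z \<le> 1 \<Longrightarrow> norm (f z) \<le> B"
  shows "f \<in> L2 \<mu>" "l2_norm \<mu> f \<le> B * sqrt (measure \<mu> UNIV)"
proof -
  have sets[measurable_cong]: "sets \<mu> = sets borel"
    and "finite_measure \<mu>" and AE: "AE z in \<mu>. norm z \<le> 1"
    using \<mu> by (auto simp: disc_measure_def finite_borel_measure_def)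
  interpret finite_measure \<mu> by fact
  have sp: "space \<mu> = UNIV" using sets_eq_imp_space_eq[OF sets] by simp
  have "norm (f 0) \<le> B" by (rule B) simp
  then have B0: "B \<ge> 0" using norm_ge_zero order_trans by blast
  have AE': "AE z in \<mu>. (norm (f z))\<^sup>2 \<le> B\<^sup>2"
    using AE by eventually_elim (auto intro: power_mono B)
  have i: "integrable \<mu> (\<lambda>z. (norm (f z))\<^sup>2)"
    using AE' by (intro integrable_const_bound[of _ "B\<^sup>2"]) auto
  then show "f \<in> L2 \<mu>" by (simp add: L2_def)
  have "(\<integral>z. (norm (f z))\<^sup>2 \<partial>\<mu>) \<le> (\<integral>z. B\<^sup>2 \<partial>\<mu>)"
    using i AE' by (intro integral_mono_AE) auto
  then have "l2_norm \<mu> f \<le> sqrt (B\<^sup>2 * measure \<mu> UNIV)"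
    unfolding l2_norm_def by (intro real_sqrt_le_mono) (simp add: sp mult.commute)
  also have "\<dots> = B * sqrt (measure \<mu> UNIV)" using B0 by (simp add: real_sqrt_mult)
  finally show "l2_norm \<mu> f \<le> B * sqrt (measure \<mu> UNIV)" .
qed

lemma borel_measurable_poly [measurable]: "poly (p :: complex poly) \<in> borel_measurable borel"
  by (intro borel_measurable_continuous_onI continuous_intros)

lemma disc_measure_poly_L2:
  assumes "disc_measure \<mu>"
  shows "poly p \<in> L2 \<mu>"
proof -
  have "bounded (poly p ` cball 0 1)"
    by (intro compact_imp_bounded compact_continuous_image continuous_intros compact_cball)
  then obtain B where "\<And>z. norm z \<le> 1 \<Longrightarrow> norm (poly p z) \<le> B"
    unfolding bounded_iff by (metis dist_0_norm image_eqI mem_cball)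
  then show ?thesis using disc_measure_bounded_L2(1)[OF assms borel_measurable_poly] by blast
qed

lemma P2_L2: "f \<in> P2 \<mu> \<Longrightarrow> f \<in> L2 \<mu>"
  by (simp add: P2_def l2_closure_def)

lemma P2_polyE:
  assumes "f \<in> P2 \<mu>" "e > 0"
  obtains p where "l2_norm \<mu> (\<lambda>z. f z - poly p z) < e"
  using assms unfolding P2_def l2_closure_def by blast

lemma uniform_limit_poly_in_P2:
  assumes \<mu>: "disc_measure \<mu>" and [measurable]: "f \<in> borel_measurable borel"
    and app: "\<And>e. e > 0 \<Longrightarrow> \<exists>p. \<forall>z. norm z \<le> 1 \<longrightarrow> norm (f z - poly p z) \<le> e"
  shows "f \<in> P2 \<mu>"
proof -
  have *: "\<exists>p. (\<lambda>z. f z - poly p z) \<in> L2 \<mu> \<and> l2_norm \<mu> (\<lambda>z. f z - poly p z) < e" if "e > 0" for e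
  proof -
    define d where "d = e / (sqrt (measure \<mu> UNIV) + 1)"
    have s: "sqrt (measure \<mu> UNIV) + 1 > 0" by (simp add: add_nonneg_pos)
    have d: "d > 0" using that s by (simp add: d_def)
    then obtain p where p: "\<And>z. norm z \<le> 1 \<Longrightarrow> norm (f z - poly p z) \<le> d" using app by blast
    have L: "(\<lambda>z. f z - poly p z) \<in> L2 \<mu>" "l2_norm \<mu> (\<lambda>z. f z - poly p z) \<le> d * sqrt (measure \<mu> UNIV)"
      by (rule disc_measure_bounded_L2[OF \<mu> _ p]; simp)+
    have "d * sqrt (measure \<mu> UNIV) < e"
      using that s by (simp add: d_def field_simps)
    with L show ?thesis by (intro exI[of _ p]) auto
  qed
  \<comment> \<open>f = (f - p) + p, a function bounded on the disc plus a polynomial.\<close>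
  from *[of 1] obtain p where "(\<lambda>z. f z - poly p z) \<in> L2 \<mu>" by auto
  from L2_add(1)[OF this disc_measure_poly_L2[OF \<mu>, of p]] have "f \<in> L2 \<mu>" by simp
  with * show ?thesis unfolding P2_def l2_closure_def by blast
qed

text \<open>The shift is a contraction because the factor z has modulus at most 1 almost
  everywhere.\<close>

lemma L2_shift:
  assumes \<mu>: "disc_measure \<mu>" and f: "f \<in> L2 \<mu>"
  shows "shift f \<in> L2 \<mu>" "l2_norm \<mu> (shift f) \<le> l2_norm \<mu> f"
proof -
  have sets[measurable_cong]: "sets \<mu> = sets borel" and AE: "AE z in \<mu>. norm z \<le> 1"
    using \<mu> by (auto simp: disc_measure_def finite_borel_measure_def)
  have [measurable]: "f \<in> borel_measurable \<mu>" and i: "integrable \<mu> (\<lambda>z. (norm (f z))\<^sup>2)"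
    using f by (auto simp: L2_def)
  have AE': "AE z in \<mu>. (norm (shift f z))\<^sup>2 \<le> (norm (f z))\<^sup>2"
    using AE by eventually_elim (auto simp: shift_def norm_mult intro!: power_mono mult_left_le_one_le)
  have [measurable]: "shift f \<in> borel_measurable \<mu>" unfolding shift_def by measurable
  have i': "integrable \<mu> (\<lambda>z. (norm (shift f z))\<^sup>2)"
    using AE' by (intro Bochner_Integration.integrable_bound[OF i]) auto
  then show "shift f \<in> L2 \<mu>" by (simp add: L2_def)
  show "l2_norm \<mu> (shift f) \<le> l2_norm \<mu> f"
    unfolding l2_norm_def using i i' AE' by (intro real_sqrt_le_mono integral_mono_AE)
qed

text \<open>If p approximates f, then the polynomial z p approximates z f at least as well, since
  the shift is a contraction.\<close>

lemma closed_invariant_subspace_P2: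
  assumes \<mu>: "disc_measure \<mu>"
  shows "closed_invariant_subspace \<mu> (P2 \<mu>)"
proof -
  have sub: "range poly \<subseteq> L2 \<mu>" using disc_measure_poly_L2[OF \<mu>] by auto
  have "shift f \<in> P2 \<mu>" if f: "f \<in> P2 \<mu>" for f
  proof -
    have "\<exists>g\<in>range poly. l2_norm \<mu> (\<lambda>z. shift f z - g z) < e" if e: "e > 0" for e
    proof -
      obtain p where p: "l2_norm \<mu> (\<lambda>z. f z - poly p z) < e"
        using P2_polyE[OF f e] by blast
      have "l2_norm \<mu> (shift (\<lambda>z. f z - poly p z)) \<le> l2_norm \<mu> (\<lambda>z. f z - poly p z)"
        using f sub by (intro L2_shift[OF \<mu>] L2_diff) (auto simp: P2_L2)
      with p show ?thesis
        by (intro bexI[of _ "poly (pCons 0 p)"]) (auto simp: shift_def algebra_simps)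
    qed
    then show ?thesis
      using L2_shift(1)[OF \<mu> P2_L2[OF f]] by (auto simp: P2_def l2_closure_def)
  qed
  then show ?thesis
    using fun_subspace_l2_closure[OF sub fun_subspace_polys] l2_closed_l2_closure[OF sub]
    by (auto simp: closed_invariant_subspace_def P2_def)
qed

section \<open>Normalized arc length on the unit circle\<close>

text \<open>Using the parametrization \<open>circlepath\<close> on the unit interval gives total
  mass 1 and lets contour integrals be read directly as integrals for this measure.\<close>

definition circle_measure :: "complex measure" where
  "circle_measure = distr (restrict_space lborel {0..1}) borel (circlepath 0 1)"

lemma borel_measurable_circlepath [measurable]: "circlepath z r \<in> borel_measurable borel"
  unfolding circlepath by (intro borel_measurable_continuous_onI continuous_intros)

lemma sets_circle_measure [measurable_cong, simp]: "sets circle_measure = sets borel"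
  by (simp add: circle_measure_def)

lemma space_circle_measure [simp]: "space circle_measure = UNIV"
  by (simp add: circle_measure_def)

lemma measurable_restrict_lborel:
  "f \<in> borel_measurable borel \<Longrightarrow> f \<in> borel_measurable (restrict_space lborel S)"
  by (intro measurable_restrict_space1) simp

lemma nn_integral_circle_measure:
  assumes [measurable]: "f \<in> borel_measurable borel"
  shows "(\<integral>\<^sup>+z. f z \<partial>circle_measure) = (\<integral>\<^sup>+t. f (circlepath 0 1 t) * indicator {0..1} t \<partial>lborel)"
  unfolding circle_measure_def
  by (subst nn_integral_distr) (auto simp: measurable_restrict_lborel nn_integral_restrict_space)

lemma emeasure_circle_measure_UNIV: "emeasure circle_measure UNIV = 1"
  using nn_integral_circle_measure[of "\<lambda>_. 1"] by simp

lemma finite_measure_circle_measure: "finite_measure circle_measure"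
  by standard (simp add: emeasure_circle_measure_UNIV)

lemma measure_circle_measure_UNIV [simp]: "measure circle_measure UNIV = 1"
  by (simp add: measure_def emeasure_circle_measure_UNIV)

lemma AE_circle_measure: "AE z in circle_measure. norm z = 1"
proof -
  have "(\<integral>\<^sup>+z. indicator {z. norm z \<noteq> 1} z \<partial>circle_measure) = 0"
    by (subst nn_integral_circle_measure) (auto simp: circlepath norm_mult)
  then have "emeasure circle_measure {z. norm z \<noteq> 1} = 0"
    by simp
  then show ?thesis
    by (intro AE_I[of _ _ "{z. norm z \<noteq> 1}"]) auto
qed

lemma integral_circle_measure:
  fixes f :: "complex \<Rightarrow> complex"
  assumes [measurable]: "f \<in> borel_measurable borel"
  shows "(\<integral>z. f z \<partial>circle_measure) = (LINT t:{0..1}|lborel. f (circlepath 0 1 t))"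
  unfolding circle_measure_def set_lebesgue_integral_def
  by (subst integral_distr) (auto simp: measurable_restrict_lborel integral_restrict_space)

section \<open>The Szego kernel and its reproducing property\<close>

definition szego :: "complex \<Rightarrow> complex \<Rightarrow> complex" where
  "szego w z = 1 / (1 - cnj w * z)"

lemma borel_measurable_szego [measurable]: "szego w \<in> borel_measurable borel"
  unfolding szego_def by measurable

lemma borel_measurable_cnj [measurable]: "cnj \<in> borel_measurable borel"
  by (intro borel_measurable_continuous_onI continuous_intros)

lemma szego_denominator:
  assumes "norm w < 1" "norm z \<le> 1"
  shows "1 - norm w \<le> norm (1 - cnj w * z)" "1 - cnj w * z \<noteq> 0"
proof -
  have "norm (cnj w * z) \<le> norm w"
    using assms by (simp add: norm_mult mult_left_le)
  moreover have "1 - norm (cnj w * z) \<le> norm (1 - cnj w * z)"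
    using norm_triangle_ineq2[of 1 "cnj w * z"] by simp
  ultimately show *: "1 - norm w \<le> norm (1 - cnj w * z)" by linarith
  show "1 - cnj w * z \<noteq> 0" using * assms by auto
qed

lemma norm_szego_le:
  assumes "norm w < 1" "norm z \<le> 1"
  shows "norm (szego w z) \<le> 1 / (1 - norm w)"
  using szego_denominator[OF assms] assms by (simp add: szego_def norm_divide frac_le)

text \<open>This is Cauchy's integral formula. On the circle cnj z = 1/z, so z / (z - w) = 1 / (1 -
  w cnj z), which is the conjugate of the kernel; the factor z comes from dz = 2 pi i z dt.\<close>

lemma szego_reproducing:
  assumes w: "norm w < 1"
  shows "(\<integral>z. poly p z * cnj (szego w z) \<partial>circle_measure) = poly p w"
proof -
  let ?c = "circlepath 0 1" and ?f = "\<lambda>z. poly p z * cnj (szego w z)"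
  have nrm: "norm (?c t) = 1" for t by (simp add: circlepath norm_mult)
  have nz: "?c t - w \<noteq> 0" "1 - w * cnj (?c t) \<noteq> 0" for t
  proof -
    show "?c t - w \<noteq> 0" using nrm[of t] w by auto
    have "norm (w * cnj (?c t)) < 1" using nrm w by (simp add: norm_mult)
    then show "1 - w * cnj (?c t) \<noteq> 0" by auto
  qed
  have unit: "?c t * cnj (?c t) = 1" for t
    using nrm[of t] by (simp add: complex_norm_square[symmetric])
  have pw: "poly p (?c t) / (?c t - w) * vector_derivative ?c (at t) = 2 * of_real pi * \<i> * ?f (?c t)" for t
  proof -
    have "?c t * (1 - w * cnj (?c t)) = ?c t - w"
      using unit[of t] by (simp add: algebra_simps)
    then have "?c t / (?c t - w) = 1 / (1 - w * cnj (?c t))"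
      using nz[of t] by (simp add: field_simps)
    moreover have "vector_derivative ?c (at t) = 2 * of_real pi * \<i> * ?c t"
      by (simp add: vector_derivative_circlepath) (simp add: circlepath)
    moreover have "poly p (?c t) / (?c t - w) * (2 * of_real pi * \<i> * ?c t) =
        2 * of_real pi * \<i> * (poly p (?c t) * (?c t / (?c t - w)))"
      by simp
    ultimately show ?thesis by (simp add: szego_def)
  qed
  have "((\<lambda>z. poly p z / (z - w)) has_contour_integral (2 * of_real pi * \<i> * poly p w)) ?c"
    using w by (intro Cauchy_integral_circlepath_simple) (auto intro!: holomorphic_intros)
  then have "((\<lambda>t. 2 * of_real pi * \<i> * ?f (?c t)) has_integral (2 * of_real pi * \<i> * poly p w)) {0..1}"
    unfolding has_contour_integral pw .
  from has_integral_mult_right[OF this, of "1 / (2 * of_real pi * \<i>)"]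
  have "((\<lambda>t. ?f (?c t)) has_integral poly p w) {0..1}"
    by (simp add: field_simps)
  \<comment> \<open>Contour integrals are gauge integrals; continuity makes this one a Lebesgue
    integral with the same value.\<close>
  moreover have "set_integrable lborel {0..1} (\<lambda>t. ?f (?c t))"
  proof (rule borel_integrable_atLeastAtMost')
    have "continuous_on {0..1} ?c" unfolding circlepath by (intro continuous_intros)
    then show "continuous_on {0..1} (\<lambda>t. ?f (?c t))"
      using nz by (auto simp: szego_def intro!: continuous_intros)
  qed
  ultimately show ?thesis
    by (subst integral_circle_measure)
      (auto simp: set_borel_integral_eq_integral integral_unique)
qed

section \<open>Arc length plus an atom at 1/2\<close>

text \<open>One pushforward replaces a sum of two measures: [0,1] winds around the circle, and the
  remaining interval (1,7], of length 6, collapses to the atom.\<close>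

definition circle_atom_measure :: "complex measure" where
  "circle_atom_measure =
     distr (restrict_space lborel {0..7}) borel (\<lambda>t. if t \<le> 1 then circlepath 0 1 t else 1/2)"

lemma sets_circle_atom_measure [measurable_cong, simp]: "sets circle_atom_measure = sets borel"
  by (simp add: circle_atom_measure_def)

lemma space_circle_atom_measure [simp]: "space circle_atom_measure = UNIV"
  by (simp add: circle_atom_measure_def)

lemma nn_integral_circle_atom_measure:
  assumes [measurable]: "f \<in> borel_measurable borel"
  shows "(\<integral>\<^sup>+z. f z \<partial>circle_atom_measure) = (\<integral>\<^sup>+z. f z \<partial>circle_measure) + f (1/2) * 6"
proof -
  have "(\<integral>\<^sup>+z. f z \<partial>circle_atom_measure) =
      (\<integral>\<^sup>+t. f (if t \<le> 1 then circlepath 0 1 t else 1/2) * indicator {0..7} t \<partial>lborel)"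
    unfolding circle_atom_measure_def
    by (subst nn_integral_distr) (auto simp: measurable_restrict_lborel nn_integral_restrict_space)
  also have "\<dots> = (\<integral>\<^sup>+t. f (circlepath 0 1 t) * indicator {0..1} t + f (1/2) * indicator {1<..7} t \<partial>lborel)"
    by (intro nn_integral_cong) (auto simp: indicator_def)
  also have "\<dots> = (\<integral>\<^sup>+z. f z \<partial>circle_measure) + f (1/2) * 6"
    by (subst nn_integral_add) (auto simp: nn_integral_circle_measure nn_integral_cmult)
  finally show ?thesis .
qed

lemma integrable_circle_atom_measure_iff:
  fixes f :: "complex \<Rightarrow> 'b :: {banach, second_countable_topology}"
  assumes [measurable]: "f \<in> borel_measurable borel"
  shows "integrable circle_atom_measure f \<longleftrightarrow> integrable circle_measure f"
  by (auto simp: integrable_iff_bounded nn_integral_circle_atom_measure ennreal_mult_less_top)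

lemma integral_circle_atom_measure:
  fixes f :: "complex \<Rightarrow> 'b :: {banach, second_countable_topology}"
  assumes [measurable]: "f \<in> borel_measurable borel" and f: "integrable circle_measure f"
  shows "(\<integral>z. f z \<partial>circle_atom_measure) = (\<integral>z. f z \<partial>circle_measure) + 6 *\<^sub>R f (1/2)"
proof -
  have i: "integrable lborel (\<lambda>t. indicator {0..1} t *\<^sub>R f (circlepath 0 1 t))"
    using f unfolding circle_measure_def
    by (subst (asm) integrable_distr_eq) (auto simp: measurable_restrict_lborel integrable_restrict_space set_integrable_def)
  have "(\<integral>z. f z \<partial>circle_atom_measure) =
      (\<integral>t. indicator {0..7} t *\<^sub>R f (if t \<le> 1 then circlepath 0 1 t else 1/2) \<partial>lborel)"
    unfolding circle_atom_measure_def
    by (subst integral_distr) (auto simp: measurable_restrict_lborel integral_restrict_space)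
  also have "\<dots> = (\<integral>t. indicator {0..1} t *\<^sub>R f (circlepath 0 1 t) + indicator {1<..7} t *\<^sub>R f (1/2) \<partial>lborel)"
    by (intro Bochner_Integration.integral_cong) (auto simp: indicator_def)
  also have "\<dots> = (\<integral>z. f z \<partial>circle_measure) + 6 *\<^sub>R f (1/2)"
    using i by (subst Bochner_Integration.integral_add)
      (auto simp: circle_measure_def integral_distr measurable_restrict_lborel integral_restrict_space)
  finally show ?thesis .
qed

text \<open>The atom has positive mass, so a property holding almost everywhere must hold there
  exactly.\<close>

lemma AE_circle_atom_measure_iff:
  assumes [measurable]: "Measurable.pred borel P"
  shows "(AE z in circle_atom_measure. P z) \<longleftrightarrow> (AE z in circle_measure. P z) \<and> P (1/2)"
proof -
  have "emeasure circle_atom_measure {z. \<not> P z} =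
      emeasure circle_measure {z. \<not> P z} + indicator {z. \<not> P z} (1/2) * 6"
    using nn_integral_circle_atom_measure[of "indicator {z. \<not> P z}"] by simp
  then show ?thesis
    by (simp add: AE_iff_measurable[OF _ refl] indicator_def)
qed

lemma disc_measure_circle_atom_measure: "disc_measure circle_atom_measure"
proof -
  have "emeasure circle_atom_measure UNIV = 1 + 6"
    using nn_integral_circle_atom_measure[of "\<lambda>_. 1"] emeasure_circle_measure_UNIV by simp
  then have "finite_measure circle_atom_measure"
    by (intro finite_measureI) simp
  moreover have "AE z in circle_atom_measure. norm z \<le> 1"
    using AE_circle_measure by (auto simp: AE_circle_atom_measure_iff norm_divide)
  ultimately show ?thesis by (simp add: disc_measure_def finite_borel_measure_def)
qed

text \<open>These bounds make circle averages and the value at the atom continuous in the norm of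
  the space. The first is Cauchy-Schwarz for a probability measure; the second holds because the
  atom has mass at least 1.\<close>

lemma L2_circle_atom_measure:
  assumes f: "f \<in> L2 circle_atom_measure"
  shows "integrable circle_measure f"
    and "(\<integral>z. norm (f z) \<partial>circle_measure) \<le> l2_norm circle_atom_measure f"
    and "norm (f (1/2)) \<le> l2_norm circle_atom_measure f"
proof -
  interpret finite_measure circle_measure by (rule finite_measure_circle_measure)
  have [measurable]: "f \<in> borel_measurable borel"
    using f measurable_cong_sets[OF sets_circle_atom_measure refl] by (auto simp: L2_def)
  have sq: "integrable circle_measure (\<lambda>z. (norm (f z))\<^sup>2)"
    using f by (subst integrable_circle_atom_measure_iff[symmetric]) (auto simp: L2_def)
  have le: "x \<le> 1 + x\<^sup>2" for x :: real
    using sum_power2_ge_zero[of "x - 1" x] by (simp add: power2_eq_square algebra_simps)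
  show i: "integrable circle_measure f"
  proof (rule Bochner_Integration.integrable_bound)
    show "integrable circle_measure (\<lambda>z. 1 + (norm (f z))\<^sup>2)" using sq by simp
    show "AE z in circle_measure. norm (f z) \<le> norm (1 + (norm (f z))\<^sup>2)"
      using le by (intro AE_I2) (auto simp: abs_of_nonneg)
  qed measurable
  define m where "m = (\<integral>z. norm (f z) \<partial>circle_measure)"
  define s where "s = (\<integral>z. (norm (f z))\<^sup>2 \<partial>circle_measure)"
  \<comment> \<open>Nonnegativity of the variance of |f|, expanded using total mass 1, yields
    Cauchy-Schwarz.\<close>
  have "0 \<le> (\<integral>z. (norm (f z) - m)\<^sup>2 \<partial>circle_measure)" by simp
  also have "\<dots> = (\<integral>z. (norm (f z))\<^sup>2 - 2 * m * norm (f z) + m\<^sup>2 \<partial>circle_measure)"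
    by (simp add: power2_diff algebra_simps)
  also have "\<dots> = s - 2 * m * m + m\<^sup>2"
    using sq i by (simp add: m_def s_def)
  finally have ms: "m\<^sup>2 \<le> s" by (simp add: power2_eq_square)
  have s0: "s \<ge> 0" by (simp add: s_def)
  have N: "l2_norm circle_atom_measure f = sqrt (s + 6 * (norm (f (1/2)))\<^sup>2)"
    using sq by (simp add: l2_norm_def integral_circle_atom_measure s_def)
  show "(\<integral>z. norm (f z) \<partial>circle_measure) \<le> l2_norm circle_atom_measure f"
    unfolding N m_def[symmetric] using ms by (intro real_le_rsqrt) (simp add: add_increasing2)
  show "norm (f (1/2)) \<le> l2_norm circle_atom_measure f"
    unfolding N using s0 by (intro real_le_rsqrt) auto
qed

section \<open>Approximation of Szego kernels and bounds for point evaluations\<close>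

text \<open>The partial sums of the geometric series converge uniformly on the closed disc: the
  remainder after n terms is (cnj w z)^n times the kernel, hence at most |w|^n / (1 - |w|).\<close>

lemma szego_in_P2:
  assumes \<mu>: "disc_measure \<mu>" and w: "norm w < 1"
  shows "szego w \<in> P2 \<mu>"
proof (rule uniform_limit_poly_in_P2[OF \<mu>])
  fix e :: real assume "e > 0"
  then have "e * (1 - norm w) > 0" using w by simp
  then obtain n where n: "norm w ^ n < e * (1 - norm w)"
    using real_arch_pow_inv w by blast
  define p where "p = (\<Sum>k<n. monom (cnj w ^ k) k)"
  have "norm (szego w z - poly p z) \<le> e" if z: "norm z \<le> 1" for z
  proof -
    have nz: "1 - cnj w * z \<noteq> 0" using szego_denominator[OF w z] by simp
    have "poly p z = (\<Sum>k<n. (cnj w * z) ^ k)"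
      by (simp add: p_def poly_sum poly_monom power_mult_distrib)
    also have "\<dots> = (1 - (cnj w * z) ^ n) / (1 - cnj w * z)"
      using nz by (subst geometric_sum) (auto simp: divide_simps algebra_simps)
    finally have "szego w z - poly p z = (cnj w * z) ^ n * szego w z"
      using nz by (simp add: szego_def divide_simps)
    then have "norm (szego w z - poly p z) = norm w ^ n * norm z ^ n * norm (szego w z)"
      by (simp add: norm_mult norm_power power_mult_distrib)
    also have "\<dots> \<le> norm w ^ n * 1 * (1 / (1 - norm w))"
      using z by (intro mult_mono norm_szego_le w power_le_one) auto
    also have "\<dots> \<le> e" using n w by (simp add: field_simps)
    finally show ?thesis .
  qed
  then show "\<exists>p. \<forall>z. norm z \<le> 1 \<longrightarrow> norm (szego w z - poly p z) \<le> e" by blast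
qed simp

lemma integrable_circle_measure:
  fixes f :: "complex \<Rightarrow> complex"
  assumes [measurable]: "f \<in> borel_measurable borel" and "continuous_on (sphere 0 1) f"
  shows "integrable circle_measure f"
proof -
  interpret finite_measure circle_measure by (rule finite_measure_circle_measure)
  have "bounded (f ` sphere 0 1)"
    using assms by (intro compact_imp_bounded compact_continuous_image) auto
  then obtain B where "\<And>z. norm z = 1 \<Longrightarrow> norm (f z) \<le> B"
    unfolding bounded_iff by (metis dist_0_norm image_eqI mem_sphere)
  then have "AE z in circle_measure. norm (f z) \<le> B"
    using AE_circle_measure by auto
  then show ?thesis by (rule integrable_const_bound) simp
qed

lemma integrable_poly_szego:
  assumes "norm w < 1"
  shows "integrable circle_measure (\<lambda>z. poly p z * cnj (szego w z))"
proof (rule integrable_circle_measure)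
  show "continuous_on (sphere 0 1) (\<lambda>z. poly p z * cnj (szego w z))"
    unfolding szego_def using szego_denominator[OF assms] by (intro continuous_intros) auto
qed measurable

text \<open>The reproducing formula combined with the bound on the kernel. Having only the circle
  mean of |p| on the right lets the same estimate serve for bounded evaluations and for carrying
  information from the circle to the atom.\<close>

lemma norm_poly_le:
  assumes "norm w < 1"
  shows "norm (poly p w) \<le> (\<integral>z. norm (poly p z) \<partial>circle_measure) / (1 - norm w)"
proof -
  have i: "integrable circle_measure (\<lambda>z. norm (poly p z))"
    by (intro integrable_norm integrable_circle_measure continuous_intros) simp
  have "norm (poly p w) \<le> (\<integral>z. norm (poly p z * cnj (szego w z)) \<partial>circle_measure)"
    unfolding szego_reproducing[OF assms, symmetric] by (rule integral_norm_bound)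
  also have "\<dots> \<le> (\<integral>z. norm (poly p z) / (1 - norm w) \<partial>circle_measure)"
  proof (rule integral_mono_AE)
    show "integrable circle_measure (\<lambda>z. norm (poly p z * cnj (szego w z)))"
      using integrable_poly_szego[OF assms] by (rule integrable_norm)
    show "integrable circle_measure (\<lambda>z. norm (poly p z) / (1 - norm w))"
      using i by simp
    show "AE z in circle_measure. norm (poly p z * cnj (szego w z)) \<le> norm (poly p z) / (1 - norm w)"
      using AE_circle_measure
    proof eventually_elim
      case (elim z)
      then show ?case
        using mult_left_mono[OF norm_szego_le[OF assms, of z] norm_ge_zero[of "poly p z"]]
        by (simp add: norm_mult)
    qed
  qed
  finally show ?thesis by simp
qed

lemma ball_subset_abpe_circle_atom_measure: "ball 0 1 \<subseteq> abpe circle_atom_measure"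
proof
  \<comment> \<open>A single constant for the whole closed disc of radius r: this gives both
    boundedness and local uniformity.\<close>
  have le: "norm (poly p z) \<le> 1 / (1 - r) * l2_norm circle_atom_measure (poly p)"
    if "norm z \<le> r" "r < 1" for z r p
  proof -
    have "norm (poly p z) \<le> (\<integral>z. norm (poly p z) \<partial>circle_measure) / (1 - norm z)"
      using that by (intro norm_poly_le) simp
    also have "\<dots> \<le> l2_norm circle_atom_measure (poly p) / (1 - r)"
      using that by (intro frac_le L2_circle_atom_measure disc_measure_poly_L2[OF disc_measure_circle_atom_measure]) auto
    finally show ?thesis by simp
  qed
  have "ball 0 1 \<subseteq> bpe circle_atom_measure"
  proof
    fix z :: complex assume "z \<in> ball 0 1"
    then show "z \<in> bpe circle_atom_measure"
      unfolding bpe_def using le[of z "norm z"] by (intro CollectI exI[of _ "1 / (1 - norm z)"]) simp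
  qed
  then have int: "ball 0 1 \<subseteq> interior (bpe circle_atom_measure)"
    by (simp add: interior_maximal)
  fix a :: complex assume a: "a \<in> ball 0 1"
  \<comment> \<open>Half the distance to the circle, so the closed disc around a stays inside the
    disc of radius |a| + r < 1.\<close>
  define r where "r = (1 - norm a) / 2"
  have r: "r > 0" "norm a + r < 1" using a by (auto simp: r_def field_simps)
  have "norm z \<le> norm a + r" if "norm (z - a) \<le> r" for z
    using norm_triangle_sub[of z a] that by simp
  then have "\<forall>z p. norm (z - a) \<le> r \<longrightarrow>
      norm (poly p z) \<le> 1 / (1 - (norm a + r)) * l2_norm circle_atom_measure (poly p)"
    using le r by blast
  moreover have "1 / (1 - (norm a + r)) > 0" using r by simp
  ultimately show "a \<in> abpe circle_atom_measure"
    using int a r unfolding abpe_def by blast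
qed

section \<open>Irreducibility\<close>

lemma P2_irreducible_circle_atom_measure: "P2_irreducible circle_atom_measure"
  unfolding P2_irreducible_def
proof (intro ballI impI)
  fix A :: "complex set"
  assume A [measurable]: "A \<in> sets borel" and P: "indicator A \<in> P2 circle_atom_measure"
  interpret finite_measure circle_measure by (rule finite_measure_circle_measure)
  let ?\<mu> = circle_atom_measure and ?\<chi> = "indicator A :: complex \<Rightarrow> complex"
  define \<alpha> where "\<alpha> = measure circle_measure A"
  have i\<chi>: "integrable circle_measure ?\<chi>" and int\<chi>: "(\<integral>z. ?\<chi> z \<partial>circle_measure) = of_real \<alpha>"
  proof -
    have eq: "?\<chi> = (\<lambda>z. of_real (indicator A z :: real))" by (auto simp: indicator_def)
    show "integrable circle_measure ?\<chi>"
      unfolding eq by (intro integrable_of_real) (simp add: less_top[symmetric])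
    show "(\<integral>z. ?\<chi> z \<partial>circle_measure) = of_real \<alpha>"
      unfolding eq by (simp add: \<alpha>_def)
  qed
  have poly_L2: "poly p \<in> L2 ?\<mu>" for p
    by (rule disc_measure_poly_L2[OF disc_measure_circle_atom_measure])
  have ip: "integrable circle_measure (poly p)" for p
    by (rule L2_circle_atom_measure[OF poly_L2])
  \<comment> \<open>The Szego kernel at 0 is the constant 1.\<close>
  have mean: "(\<integral>z. poly p z \<partial>circle_measure) = poly p 0" for p
    using szego_reproducing[of 0 p] by (simp add: szego_def)
  have \<alpha>: "0 \<le> \<alpha>" "\<alpha> \<le> 1"
    unfolding \<alpha>_def using bounded_measure[of A] by auto
  have ex: "\<exists>p. (\<lambda>z. ?\<chi> z - poly p z) \<in> L2 ?\<mu> \<and> l2_norm ?\<mu> (\<lambda>z. ?\<chi> z - poly p z) < e" if "e > 0" for e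
    using P2_polyE[OF P that] L2_diff[OF P2_L2[OF P] poly_L2] by metis
  \<comment> \<open>If p is close to the indicator, then p^2 is close to it in mean. Hence p(0) and
    p(0)^2 are both close to \<alpha>, which forces \<alpha> = \<alpha>^2.\<close>
  have "norm (of_real (\<alpha> - \<alpha>\<^sup>2) :: complex) \<le> 0 + e" if "e > 0" for e
  proof -
    \<comment> \<open>The bound d \<le> 1 gives d^2 \<le> d and |\<alpha> + p(0)| \<le> 3; the 6
      collects two final errors of 3 d each.\<close>
    define d where "d = min 1 (e / 6)"
    have d: "d > 0" "d \<le> 1" "6 * d \<le> e" using that by (auto simp: d_def)
    obtain p where L: "(\<lambda>z. ?\<chi> z - poly p z) \<in> L2 ?\<mu>" and p: "l2_norm ?\<mu> (\<lambda>z. ?\<chi> z - poly p z) < d"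
      using ex[OF d(1)] by blast
    note b = L2_circle_atom_measure[OF L]
    have sq: "integrable circle_measure (\<lambda>z. (norm (?\<chi> z - poly p z))\<^sup>2)"
      using L by (subst integrable_circle_atom_measure_iff[symmetric]) (auto simp: L2_def)
    have "(\<integral>z. (norm (?\<chi> z - poly p z))\<^sup>2 \<partial>circle_measure) \<le> (l2_norm ?\<mu> (\<lambda>z. ?\<chi> z - poly p z))\<^sup>2"
      using sq by (simp add: l2_norm_def integral_circle_atom_measure)
    also have "\<dots> \<le> d\<^sup>2" using p by (intro power_mono) auto
    also have "\<dots> \<le> d" using d by (simp add: power2_eq_square mult_left_le)
    finally have sqd: "(\<integral>z. (norm (?\<chi> z - poly p z))\<^sup>2 \<partial>circle_measure) \<le> d" .
    have "norm (of_real \<alpha> - poly p 0) = norm (\<integral>z. ?\<chi> z - poly p z \<partial>circle_measure)"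
      using i\<chi> ip[of p] by (simp add: int\<chi> mean)
    also have "\<dots> \<le> (\<integral>z. norm (?\<chi> z - poly p z) \<partial>circle_measure)" by (rule integral_norm_bound)
    finally have 1: "norm (of_real \<alpha> - poly p 0) \<le> d" using b p by linarith
    have ip2: "integrable circle_measure (\<lambda>z. (poly p z)\<^sup>2)"
    proof -
      have "poly (p ^ 2) = (\<lambda>z. (poly p z)\<^sup>2)" by (simp add: poly_power fun_eq_iff)
      with ip[of "p ^ 2"] show ?thesis by simp
    qed
    have "norm (of_real \<alpha> - (poly p 0)\<^sup>2) = norm (\<integral>z. ?\<chi> z - (poly p z)\<^sup>2 \<partial>circle_measure)"
      using i\<chi> ip2 mean[of "p ^ 2"] by (simp add: int\<chi> poly_power)
    also have "\<dots> \<le> (\<integral>z. norm (?\<chi> z - (poly p z)\<^sup>2) \<partial>circle_measure)" by (rule integral_norm_bound)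
    also have "\<dots> \<le> (\<integral>z. 2 * norm (?\<chi> z - poly p z) + (norm (?\<chi> z - poly p z))\<^sup>2 \<partial>circle_measure)"
    proof (rule integral_mono)
      show "integrable circle_measure (\<lambda>z. norm (?\<chi> z - (poly p z)\<^sup>2))"
        using i\<chi> ip2 by (intro integrable_norm Bochner_Integration.integrable_diff)
      show "integrable circle_measure (\<lambda>z. 2 * norm (?\<chi> z - poly p z) + (norm (?\<chi> z - poly p z))\<^sup>2)"
        using b(1) sq by simp
      fix z
      \<comment> \<open>Idempotence of the indicator. Only the bounded indicator multiplies the
        linear error term, so no pointwise bound on p is required.\<close>
      have "?\<chi> z - (poly p z)\<^sup>2 = 2 * ?\<chi> z * (?\<chi> z - poly p z) - (?\<chi> z - poly p z)\<^sup>2"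
        by (auto simp: indicator_def power2_eq_square algebra_simps)
      then have "norm (?\<chi> z - (poly p z)\<^sup>2) \<le> norm (2 * ?\<chi> z * (?\<chi> z - poly p z)) + norm ((?\<chi> z - poly p z)\<^sup>2)"
        by (simp add: norm_triangle_ineq4)
      then show "norm (?\<chi> z - (poly p z)\<^sup>2) \<le> 2 * norm (?\<chi> z - poly p z) + (norm (?\<chi> z - poly p z))\<^sup>2"
        by (auto simp: norm_mult norm_power indicator_def split: if_splits)
    qed
    also have "\<dots> = 2 * (\<integral>z. norm (?\<chi> z - poly p z) \<partial>circle_measure) + (\<integral>z. (norm (?\<chi> z - poly p z))\<^sup>2 \<partial>circle_measure)"
      using b(1) sq by simp
    finally have 2: "norm (of_real \<alpha> - (poly p 0)\<^sup>2) \<le> 3 * d" using b p sqd by linarith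
    have "norm ((poly p 0)\<^sup>2 - (of_real \<alpha>)\<^sup>2) = norm (of_real \<alpha> - poly p 0) * norm (of_real \<alpha> + poly p 0)"
      unfolding norm_mult[symmetric] norm_minus_commute[of "(poly p 0)\<^sup>2"]
      by (simp add: power2_eq_square algebra_simps)
    also have "\<dots> \<le> d * 3"
    proof (intro mult_mono 1)
      have "norm (of_real \<alpha> + poly p 0) \<le> norm (2 * of_real \<alpha> :: complex) + norm (of_real \<alpha> - poly p 0)"
        using norm_triangle_ineq4[of "2 * of_real \<alpha>" "of_real \<alpha> - poly p 0"] by simp
      then show "norm (of_real \<alpha> + poly p 0) \<le> 3" using 1 d \<alpha> by (simp add: norm_mult)
    qed (use d in auto)
    finally have 3: "norm ((poly p 0)\<^sup>2 - (of_real \<alpha>)\<^sup>2) \<le> 3 * d" by simp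
    have "norm (of_real (\<alpha> - \<alpha>\<^sup>2) :: complex) \<le> 3 * d + 3 * d"
      using norm_triangle_le[OF add_mono[OF 2 3]] by simp
    with d show ?thesis by simp
  qed
  then have "norm (of_real (\<alpha> - \<alpha>\<^sup>2) :: complex) \<le> 0" by (rule field_le_epsilon)
  then have "\<alpha> = \<alpha>\<^sup>2" by (simp del: of_real_diff)
  then have \<alpha>01: "\<alpha> = 0 \<or> \<alpha> = 1" by (auto simp: power2_eq_square)
  have AE0: "AE z in circle_measure. ?\<chi> z = of_real \<alpha>"
    using \<alpha>01
  proof
    assume "\<alpha> = 0"
    then have "A \<in> null_sets circle_measure" by (auto simp: \<alpha>_def emeasure_eq_measure)
    then have "AE z in circle_measure. z \<notin> A" by (rule AE_not_in)
    then show ?thesis using \<open>\<alpha> = 0\<close> by auto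
  next
    assume "\<alpha> = 1"
    then have "measure circle_measure (space circle_measure - A) = 0"
      by (subst finite_measure_compl) (auto simp: \<alpha>_def)
    then have "UNIV - A \<in> null_sets circle_measure" by (auto simp: emeasure_eq_measure)
    then have "AE z in circle_measure. z \<notin> UNIV - A" by (rule AE_not_in)
    then show ?thesis using \<open>\<alpha> = 1\<close> by auto
  qed
  \<comment> \<open>On the circle the indicator equals \<alpha>, so p - \<alpha> has a small mean
    modulus there and thus a small value at 1/2, while the mass at the atom keeps p(1/2) near the
    indicator. Evaluation at 1/2 costs a factor 2, so the errors are 2 e/3 and e/3.\<close>
  have "norm (?\<chi> (1/2) - of_real \<alpha>) \<le> 0 + e" if "e > 0" for e
  proof -
    have "e / 3 > 0" using that by simp
    then obtain p where L: "(\<lambda>z. ?\<chi> z - poly p z) \<in> L2 ?\<mu>" and p: "l2_norm ?\<mu> (\<lambda>z. ?\<chi> z - poly p z) < e / 3"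
      using ex by blast
    note b = L2_circle_atom_measure[OF L]
    have "norm (poly (p - [:of_real \<alpha>:]) (1/2)) \<le>
        (\<integral>z. norm (poly (p - [:of_real \<alpha>:]) z) \<partial>circle_measure) / (1 - norm (1/2 :: complex))"
      by (rule norm_poly_le) (simp add: norm_divide)
    also have "(\<integral>z. norm (poly (p - [:of_real \<alpha>:]) z) \<partial>circle_measure) = (\<integral>z. norm (?\<chi> z - poly p z) \<partial>circle_measure)"
      using AE0 by (intro integral_cong_AE) (auto simp: norm_minus_commute)
    finally have "norm (poly p (1/2) - of_real \<alpha>) \<le> 2 * (e / 3)"
      using b p by (simp add: norm_divide)
    with b p norm_triangle_ineq[of "?\<chi> (1/2) - poly p (1/2)" "poly p (1/2) - of_real \<alpha>"]
    show ?thesis by simp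
  qed
  then have "norm (?\<chi> (1/2) - of_real \<alpha>) \<le> 0" by (rule field_le_epsilon)
  then have atom: "?\<chi> (1/2) = of_real \<alpha>" by simp
  show "(AE z in ?\<mu>. z \<notin> A) \<or> (AE z in ?\<mu>. z \<in> A)"
    using \<alpha>01
  proof
    assume "\<alpha> = 0"
    with AE0 atom have "AE z in ?\<mu>. z \<notin> A"
      by (auto simp: AE_circle_atom_measure_iff indicator_def)
    then show ?thesis ..
  next
    assume "\<alpha> = 1"
    with AE0 atom have "AE z in ?\<mu>. z \<in> A"
      by (auto simp: AE_circle_atom_measure_iff indicator_def split: if_splits)
    then show ?thesis ..
  qed
qed

section \<open>The reproducing kernel at 2/3 for the measure with the atom\<close>

text \<open>
  This is \<open>K\<^sub>w(z) / z\<close>. It is written in partial fractions rather than as \<open>1 / ((3 - 2 z) (2 - z))\<close> so that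
  the membership in \<open>P2\<close> needs no case distinction at the poles, where division yields 0.
\<close>

definition kernel_quotient :: "complex \<Rightarrow> complex" where
  "kernel_quotient z = 2/3 * szego (2/3) z + (-1/2) * szego (1/2) z"

lemma kernel_quotient_in_P2: "kernel_quotient \<in> P2 circle_atom_measure"
proof -
  have subspace: "fun_subspace (P2 circle_atom_measure)"
    using closed_invariant_subspace_P2[OF disc_measure_circle_atom_measure]
    by (simp add: closed_invariant_subspace_def)
  then have add: "(\<lambda>z. f z + g z) \<in> P2 circle_atom_measure"
    if "f \<in> P2 circle_atom_measure" "g \<in> P2 circle_atom_measure" for f g
    using that by (simp add: fun_subspace_def)
  have cmult: "(\<lambda>z. c * f z) \<in> P2 circle_atom_measure" if "f \<in> P2 circle_atom_measure" for c f
    using subspace that by (simp add: fun_subspace_def)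
  show ?thesis
    unfolding kernel_quotient_def[abs_def]
    by (intro add cmult szego_in_P2[OF disc_measure_circle_atom_measure]; simp add: norm_divide)
qed

text \<open>For a = 2/3 and a = 1/2, a z times the kernel at a is that kernel minus 1; the two
  constants cancel in the difference. On the closed disc the poles 3/2 and 2, where division by zero
  breaks the identity, are avoided.\<close>

lemma shift_kernel_quotient:
  assumes "norm z \<le> 1"
  shows "shift kernel_quotient z = szego (2/3) z - szego (1/2) z"
proof -
  have "1 - 2/3 * z \<noteq> 0" "1 - 1/2 * z \<noteq> 0"
    using szego_denominator(2)[of "2/3" z] szego_denominator(2)[of "1/2" z] assms
    by (simp_all add: norm_divide)
  then show ?thesis
    by (simp add: shift_def kernel_quotient_def szego_def divide_simps)
qed

lemma borel_measurable_shift_kernel_quotient [measurable]: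
  "shift kernel_quotient \<in> borel_measurable borel"
  unfolding shift_def kernel_quotient_def by measurable

lemma norm_shift_kernel_quotient_le:
  assumes "norm z \<le> 1"
  shows "norm (shift kernel_quotient z) \<le> 5"
proof -
  have "norm (szego (2/3) z) \<le> 3" "norm (szego (1/2) z) \<le> 2"
    using norm_szego_le[of "2/3" z] norm_szego_le[of "1/2" z] assms by (simp_all add: norm_divide)
  then show ?thesis
    unfolding shift_kernel_quotient[OF assms] by (intro norm_triangle_le_diff) simp
qed

text \<open>Here the mass 6 is used. The circle contributes p(2/3) - p(1/2), and the kernel has the
  value 3/2 - 4/3 = 1/6 at the atom, whose contribution is therefore exactly p(1/2).\<close>

lemma l2_inner_poly_shift_kernel_quotient:
  "l2_inner circle_atom_measure (poly p) (shift kernel_quotient) = poly p (2/3)"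
proof -
  let ?K = "shift kernel_quotient"
  have n: "norm (2/3 :: complex) < 1" "norm (1/2 :: complex) < 1" by (simp_all add: norm_divide)
  have AE: "AE z in circle_measure. poly p z * cnj (?K z) =
      poly p z * cnj (szego (2/3) z) - poly p z * cnj (szego (1/2) z)"
    using AE_circle_measure by eventually_elim (simp add: shift_kernel_quotient algebra_simps)
  note i = integrable_poly_szego[OF n(1), of p] integrable_poly_szego[OF n(2), of p]
  have "integrable circle_measure (\<lambda>z. poly p z * cnj (?K z))"
    using i by (subst integrable_cong_AE[OF _ _ AE]) auto
  then have "l2_inner circle_atom_measure (poly p) ?K =
      (\<integral>z. poly p z * cnj (?K z) \<partial>circle_measure) + 6 * (poly p (1/2) * cnj (?K (1/2)))"
    unfolding l2_inner_def by (subst integral_circle_atom_measure) (auto simp: scaleR_conv_of_real)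
  also have "(\<integral>z. poly p z * cnj (?K z) \<partial>circle_measure) = poly p (2/3) - poly p (1/2)"
    using i szego_reproducing[OF n(1), of p] szego_reproducing[OF n(2), of p]
    by (subst integral_cong_AE[OF _ _ AE]) auto
  also have "?K (1/2) = 1/6"
    by (simp add: shift_def kernel_quotient_def szego_def)
  finally show ?thesis by simp
qed

text \<open>Continuity of this functional extends evaluation at 2/3 from polynomials to their
  closure. With 5 bounding the kernel on the disc, the circle costs 5 and the atom 6 times 5, which
  makes 35.\<close>

lemma l2_inner_shift_kernel_quotient:
  assumes f: "f \<in> L2 circle_atom_measure"
  shows "integrable circle_atom_measure (\<lambda>z. f z * cnj (shift kernel_quotient z))"
    and "norm (l2_inner circle_atom_measure f (shift kernel_quotient)) \<le> 35 * l2_norm circle_atom_measure f"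
proof -
  let ?K = "shift kernel_quotient"
  have [measurable]: "f \<in> borel_measurable borel"
    using f measurable_cong_sets[OF sets_circle_atom_measure refl] by (auto simp: L2_def)
  have i: "integrable circle_atom_measure (\<lambda>z. 5 * norm (f z))"
    using L2_circle_atom_measure(1)[OF f] by (subst integrable_circle_atom_measure_iff) auto
  have "AE z in circle_atom_measure. norm z \<le> 1"
    using disc_measure_circle_atom_measure by (simp add: disc_measure_def)
  then have AE: "AE z in circle_atom_measure. norm (f z * cnj (?K z)) \<le> 5 * norm (f z)"
  proof eventually_elim
    case (elim z)
    then show ?case
      using mult_left_mono[OF norm_shift_kernel_quotient_le norm_ge_zero[of "f z"]]
      by (simp add: norm_mult mult.commute)
  qed
  then show int: "integrable circle_atom_measure (\<lambda>z. f z * cnj (?K z))"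
    by (intro Bochner_Integration.integrable_bound[OF i]) auto
  have "norm (l2_inner circle_atom_measure f ?K) \<le> (\<integral>z. norm (f z * cnj (?K z)) \<partial>circle_atom_measure)"
    unfolding l2_inner_def by (rule integral_norm_bound)
  also have "\<dots> \<le> (\<integral>z. 5 * norm (f z) \<partial>circle_atom_measure)"
    using int i AE by (intro integral_mono_AE) auto
  also have "\<dots> = 5 * (\<integral>z. norm (f z) \<partial>circle_measure) + 30 * norm (f (1/2))"
    using L2_circle_atom_measure(1)[OF f] by (subst integral_circle_atom_measure) auto
  also have "\<dots> \<le> 35 * l2_norm circle_atom_measure f"
    using L2_circle_atom_measure(2,3)[OF f] by linarith
  finally show "norm (l2_inner circle_atom_measure f ?K) \<le> 35 * l2_norm circle_atom_measure f" .
qed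

text \<open>This is the subspace of functions vanishing at 2/3, where the value of a limit of
  polynomials is given by the inner product with the kernel. Invariance amounts to the shift
  multiplying that value by 2/3.\<close>

lemma closed_invariant_subspace_kernel_perp:
  "closed_invariant_subspace circle_atom_measure
     {f \<in> P2 circle_atom_measure. l2_inner circle_atom_measure f (shift kernel_quotient) = 0}"
  (is "closed_invariant_subspace ?\<mu> ?N")
proof -
  let ?\<phi> = "\<lambda>f. l2_inner ?\<mu> f (shift kernel_quotient)"
  note \<mu> = disc_measure_circle_atom_measure
  note bound = l2_inner_shift_kernel_quotient(2)
  have P2: "fun_subspace (P2 ?\<mu>)" "l2_closed ?\<mu> (P2 ?\<mu>)" "shift ` P2 ?\<mu> \<subseteq> P2 ?\<mu>"
    using closed_invariant_subspace_P2[OF \<mu>] by (auto simp: closed_invariant_subspace_def)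
  have add: "?\<phi> (\<lambda>z. f z + g z) = ?\<phi> f + ?\<phi> g" if "f \<in> L2 ?\<mu>" "g \<in> L2 ?\<mu>" for f g
    using that[THEN l2_inner_shift_kernel_quotient(1)] by (simp add: l2_inner_def distrib_right)
  have cmult: "?\<phi> (\<lambda>z. c * f z) = c * ?\<phi> f" for c f
    by (simp add: l2_inner_def mult.assoc)
  have diff: "?\<phi> (\<lambda>z. f z - g z) = ?\<phi> f - ?\<phi> g" if "f \<in> L2 ?\<mu>" "g \<in> L2 ?\<mu>" for f g
    using that[THEN l2_inner_shift_kernel_quotient(1)] by (simp add: l2_inner_def left_diff_distrib)
  \<comment> \<open>True for polynomials by evaluation at 2/3, and carried to limits by continuity.
    Two errors, each at most 35 times the distance, explain e / 70.\<close>
  have shift: "?\<phi> (shift f) = 2/3 * ?\<phi> f" if f: "f \<in> P2 ?\<mu>" for f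
  proof -
    have "norm (?\<phi> (shift f) - 2/3 * ?\<phi> f) \<le> 0 + e" if "e > 0" for e
    proof -
      have "e / 70 > 0" using that by simp
      then obtain p where p: "l2_norm ?\<mu> (\<lambda>z. f z - poly p z) < e / 70"
        using P2_polyE[OF f] by blast
      let ?d = "\<lambda>z. f z - poly p z"
      have L: "f \<in> L2 ?\<mu>" "poly p \<in> L2 ?\<mu>" "poly (pCons 0 p) \<in> L2 ?\<mu>"
        using P2_L2[OF f] disc_measure_poly_L2[OF \<mu>] by auto
      then have d: "?d \<in> L2 ?\<mu>" by (intro L2_diff)
      have sd: "shift ?d = (\<lambda>z. shift f z - poly (pCons 0 p) z)"
        by (auto simp: shift_def algebra_simps)
      have "?\<phi> (shift ?d) = ?\<phi> (shift f) - ?\<phi> (poly (pCons 0 p))"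
        unfolding sd using L L2_shift(1)[OF \<mu> L(1)] by (intro diff)
      moreover have "?\<phi> ?d = ?\<phi> f - ?\<phi> (poly p)" using L by (intro diff)
      \<comment> \<open>The polynomial terms cancel, because z p takes the value 2/3 p(2/3) at
        2/3.\<close>
      ultimately have eq: "?\<phi> (shift f) - 2/3 * ?\<phi> f = ?\<phi> (shift ?d) - 2/3 * ?\<phi> ?d"
        unfolding l2_inner_poly_shift_kernel_quotient by (simp add: right_diff_distrib)
      have "norm (2/3 * ?\<phi> ?d) \<le> norm (?\<phi> ?d)"
        unfolding norm_mult by (rule mult_left_le_one_le) (simp_all add: norm_divide)
      then have "norm (?\<phi> (shift f) - 2/3 * ?\<phi> f) \<le> norm (?\<phi> (shift ?d)) + norm (?\<phi> ?d)"
        unfolding eq using norm_triangle_ineq4[of "?\<phi> (shift ?d)" "2/3 * ?\<phi> ?d"] by linarith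
      moreover have "norm (?\<phi> (shift ?d)) \<le> 35 * l2_norm ?\<mu> (shift ?d)"
        using d by (intro bound L2_shift(1)[OF \<mu>])
      ultimately show ?thesis
        using bound[OF d] L2_shift(2)[OF \<mu> d] p by linarith
    qed
    then have "norm (?\<phi> (shift f) - 2/3 * ?\<phi> f) \<le> 0" by (rule field_le_epsilon)
    then show ?thesis by simp
  qed
  have closed: "f \<in> ?N" if f: "f \<in> l2_closure ?\<mu> ?N" for f
  proof -
    have "f \<in> l2_closure ?\<mu> (P2 ?\<mu>)" using f unfolding l2_closure_def by blast
    then have fP: "f \<in> P2 ?\<mu>" using P2(2) by (auto simp: l2_closed_def)
    have "norm (?\<phi> f) \<le> 0 + e" if "e > 0" for e
    proof -
      have "e / 35 > 0" using that by simp
      then obtain g where g: "g \<in> ?N" "l2_norm ?\<mu> (\<lambda>z. f z - g z) < e / 35"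
        using l2_closureE[OF f] by blast
      have L: "f \<in> L2 ?\<mu>" "g \<in> L2 ?\<mu>" using fP g by (auto intro: P2_L2)
      from bound[OF L2_diff[OF L]] g show ?thesis by (simp add: diff[OF L])
    qed
    then have "norm (?\<phi> f) \<le> 0" by (rule field_le_epsilon)
    with fP show ?thesis by simp
  qed
  have "fun_subspace ?N"
    using P2(1) add cmult P2_L2 by (auto simp: fun_subspace_def l2_inner_def)
  moreover have "shift ` ?N \<subseteq> ?N"
  proof
    fix h assume "h \<in> shift ` ?N"
    then obtain f where f: "h = shift f" "f \<in> P2 ?\<mu>" "?\<phi> f = 0" by blast
    then show "h \<in> ?N" using P2(3) shift[OF f(2)] by auto
  qed
  moreover have "l2_closed ?\<mu> ?N"
    unfolding l2_closed_def by (rule subsetI) (rule closed)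
  moreover have "?N \<subseteq> P2 ?\<mu>" by blast
  ultimately show ?thesis
    unfolding closed_invariant_subspace_def by (intro conjI)
qed

theorem theorem2p2:
  "\<exists>\<mu> :: complex measure.
     finite_borel_measure \<mu> \<and> msupport \<mu> \<subseteq> cball 0 1 \<and>
     emeasure \<mu> (sphere 0 1) > 0 \<and>
     P2_irreducible \<mu> \<and>
     ball 0 1 \<subseteq> abpe \<mu> \<and>
     (\<exists>M. closed_invariant_subspace \<mu> M \<and>
          invariant_hull \<mu> (orth_within \<mu> M (shift ` M)) \<noteq> M)"
proof (intro exI conjI)
  let ?\<mu> = circle_atom_measure
  note \<mu> = disc_measure_circle_atom_measure
  show "finite_borel_measure ?\<mu>" using \<mu> by (simp add: disc_measure_def)
  have AE: "AE z in ?\<mu>. norm z \<le> 1" using \<mu> by (simp add: disc_measure_def)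
  show "msupport ?\<mu> \<subseteq> cball 0 1"
  proof
    fix z assume z: "z \<in> msupport ?\<mu>"
    show "z \<in> cball 0 1"
    proof (rule ccontr)
      assume "z \<notin> cball 0 1"
      \<comment> \<open>The complement of the closed disc is an open neighbourhood of z, yet a null
        set.\<close>
      then have "emeasure ?\<mu> (- cball 0 1) > 0"
        using z unfolding msupport_def by (auto dest: spec[of _ "- cball 0 1"])
      moreover have "emeasure ?\<mu> (- cball 0 1) = 0"
        using AE by (subst (asm) AE_iff_measurable[OF _ refl]) (auto simp: Compl_eq not_le)
      ultimately show False by simp
    qed
  qed
  have "emeasure circle_measure (sphere 0 1) = emeasure circle_measure UNIV"
    using AE_circle_measure by (intro emeasure_eq_AE) auto
  moreover have "emeasure ?\<mu> (sphere 0 1) \<ge> emeasure circle_measure (sphere 0 1)"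
    using nn_integral_circle_atom_measure[OF borel_measurable_indicator[OF borel_closed[OF closed_sphere]]]
    by simp
  ultimately show "emeasure ?\<mu> (sphere 0 1) > 0"
    using emeasure_circle_measure_UNIV by (simp add: less_le_trans[OF zero_less_one])
  show "P2_irreducible ?\<mu>" by (rule P2_irreducible_circle_atom_measure)
  show "ball 0 1 \<subseteq> abpe ?\<mu>" by (rule ball_subset_abpe_circle_atom_measure)
  show "closed_invariant_subspace ?\<mu> (P2 ?\<mu>)" by (rule closed_invariant_subspace_P2[OF \<mu>])
  let ?N = "{f \<in> P2 ?\<mu>. l2_inner ?\<mu> f (shift kernel_quotient) = 0}"
  \<comment> \<open>Since \<open>kernel_quotient\<close> lies in the space, the kernel is a shift of
    one of its elements, so orthogonality to all shifts includes orthogonality to the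
    kernel.\<close>
  have "orth_within ?\<mu> (P2 ?\<mu>) (shift ` P2 ?\<mu>) \<subseteq> ?N"
    using kernel_quotient_in_P2 by (auto simp: orth_within_def)
  then have "invariant_hull ?\<mu> (orth_within ?\<mu> (P2 ?\<mu>) (shift ` P2 ?\<mu>)) \<subseteq> ?N"
    using closed_invariant_subspace_kernel_perp by (auto simp: invariant_hull_def)
  moreover have "poly 1 \<in> P2 ?\<mu>"
    using disc_measure_poly_L2[OF \<mu>, of 1]
    by (auto simp: P2_def l2_closure_def l2_norm_def intro!: exI[of _ "1 :: complex poly"])
  \<comment> \<open>Its inner product with the kernel is its value 1 at 2/3.\<close>
  moreover have "poly 1 \<notin> ?N"
    using l2_inner_poly_shift_kernel_quotient[of 1] by simp
  ultimately show "invariant_hull ?\<mu> (orth_within ?\<mu> (P2 ?\<mu>) (shift ` P2 ?\<mu>)) \<noteq> P2 ?\<mu>"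
    by blast
qed

end
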